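(* There is no universal constant $C$ such that, for any two finite connected graphs $G_1$ and $G_2$, $$P_{1/2}(G_1\times G_2)\le C\,P_{1/2}(G_1)\cdot P_{1/2}(G_2),$$ where $P_{1/2}$ is taken with respect to $2$-pebbling.
   Context: $G_1\times G_2$ denotes the Cartesian product of graphs: its vertex set is $V(G_1)\times V(G_2)$, and $(u_1,u_2)$ is adjacent to $(w_1,w_2)$ iff either $u_1=w_1$ and $u_2w_2\in E(G_2)$, or $u_2=w_2$ and $u_1w_1\in E(G_1)$. A configuration of $k$ pebbles on $G$ is a multiset of $k$ vertices of $G$ (pebbles are unlabelled). A $2$-pebbling move removes two pebbles from a vertex and adds one pebble to one of its neighbours. A configuration is $v$-solvable if some finite (possibly empty) sequence of moves leads to a configuration with at least one pebble on $v$, and it is solvable if it is $v$-solvable for every vertex $v$. $\mathcal{D}_{G,k}$ is the probability space of all configurations of $k$ unlabelled pebbles on $V(G)$, with the uniform distribution over all $\binom{|V(G)|+k-1}{k}$ configurations, and $$P_{1/2}(G)=\min\left\{k \;\middle|\; \mathbb{P}\left(D\in\mathcal{D}_{G,k}\text{ is solvable}\right)\ge\tfrac12\right\}.$$ *)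

theory Defs
  imports "HOL-Probability.Probability_Mass_Function" "Graph_Theory.Graph_Theory"
begin

text \<open>
  Graphs are taken from the Graph-Theory entry: \<open>pair_graph G\<close> says that \<open>G\<close> is a finite simple
  graph, given by a finite vertex set and a symmetric irreflexive set of arcs (each edge \<open>uv\<close> is
  represented by both \<open>(u, v)\<close> and \<open>(v, u)\<close>). Its notion of connectedness requires at least one
  vertex; it lives on the more general digraph type, into which \<open>with_proj\<close> embeds.
\<close>

definition finite_connected_graph :: "'a pair_pre_digraph \<Rightarrow> bool" where
  "finite_connected_graph G \<longleftrightarrow> pair_graph G \<and> Digraph_Component.connected (with_proj G)"

definition cartesian_product ::
  "'a pair_pre_digraph \<Rightarrow> 'b pair_pre_digraph \<Rightarrow> ('a \<times> 'b) pair_pre_digraph" where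
  "cartesian_product G\<^sub>1 G\<^sub>2 =
     \<lparr> pverts = pverts G\<^sub>1 \<times> pverts G\<^sub>2,
       parcs = {((u\<^sub>1, u\<^sub>2), (w\<^sub>1, w\<^sub>2)) | u\<^sub>1 u\<^sub>2 w\<^sub>1 w\<^sub>2.
         u\<^sub>1 \<in> pverts G\<^sub>1 \<and> w\<^sub>1 \<in> pverts G\<^sub>1 \<and> u\<^sub>2 \<in> pverts G\<^sub>2 \<and> w\<^sub>2 \<in> pverts G\<^sub>2 \<and>
         (u\<^sub>1 = w\<^sub>1 \<and> (u\<^sub>2, w\<^sub>2) \<in> parcs G\<^sub>2 \<or> u\<^sub>2 = w\<^sub>2 \<and> (u\<^sub>1, w\<^sub>1) \<in> parcs G\<^sub>1)} \<rparr>"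

definition configurations :: "'a pair_pre_digraph \<Rightarrow> nat \<Rightarrow> 'a multiset set" where
  "configurations G k = {D. set_mset D \<subseteq> pverts G \<and> size D = k}"

inductive pebbling_move :: "'a pair_pre_digraph \<Rightarrow> 'a multiset \<Rightarrow> 'a multiset \<Rightarrow> bool"
  for G :: "'a pair_pre_digraph" where
  "(u, w) \<in> parcs G \<Longrightarrow> 2 \<le> count D u \<Longrightarrow> pebbling_move G D (D - {#u, u#} + {#w#})"

definition vertex_solvable :: "'a pair_pre_digraph \<Rightarrow> 'a \<Rightarrow> 'a multiset \<Rightarrow> bool" where
  "vertex_solvable G v D \<longleftrightarrow> (\<exists>D'. (pebbling_move G)\<^sup>*\<^sup>* D D' \<and> v \<in># D')"

definition solvable :: "'a pair_pre_digraph \<Rightarrow> 'a multiset \<Rightarrow> bool" where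
  "solvable G D \<longleftrightarrow> (\<forall>v \<in> pverts G. vertex_solvable G v D)"

definition P_half :: "'a pair_pre_digraph \<Rightarrow> nat" where
  "P_half G =
     (LEAST k. measure_pmf.prob (pmf_of_set (configurations G k)) {D. solvable G D} \<ge> 1/2)"

text \<open>
  The next facts show that these definitions are meaningful: the product of two finite connected
  graphs is one again, the uniform distribution is taken over a finite nonempty set, and the minimum
  defining \<open>P_half\<close> is attained.
\<close>

lemma finite_configurations:
  assumes "finite (pverts G)"
  shows "finite (configurations G k)"
proof -
  have "configurations G k \<subseteq> mset ` {xs. set xs \<subseteq> pverts G \<and> length xs = k}"
  proof
    fix D assume D: "D \<in> configurations G k"
    obtain xs where "mset xs = D" using ex_mset by blast
    with D show "D \<in> mset ` {xs. set xs \<subseteq> pverts G \<and> length xs = k}"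
      unfolding configurations_def by (auto intro!: image_eqI[of _ _ xs])
  qed
  with finite_lists_length_eq[OF assms] show ?thesis
    by (meson finite_imageI finite_subset)
qed

lemma configurations_nonempty:
  assumes "pverts G \<noteq> {}"
  shows "configurations G k \<noteq> {}"
proof -
  obtain v where "v \<in> pverts G" using assms by blast
  then have "replicate_mset k v \<in> configurations G k"
    by (auto simp: configurations_def)
  then show ?thesis by blast
qed

lemma finite_connected_graph_iff:
  "finite_connected_graph G \<longleftrightarrow>
     finite (pverts G) \<and> pverts G \<noteq> {} \<and> parcs G \<subseteq> pverts G \<times> pverts G \<and>
     sym (parcs G) \<and> irrefl (parcs G) \<and>
     (\<forall>u \<in> pverts G. \<forall>v \<in> pverts G. (u, v) \<in> (parcs G)\<^sup>*)" (is "?L \<longleftrightarrow> ?R")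
proof -
  have graph: "pair_graph G \<longleftrightarrow> finite (pverts G) \<and> parcs G \<subseteq> pverts G \<times> pverts G \<and>
     sym (parcs G) \<and> irrefl (parcs G)" (is "_ \<longleftrightarrow> ?P")
  proof
    assume "pair_graph G"
    then interpret pair_graph G .
    have "irrefl (parcs G)" using no_loops' by (auto simp: irrefl_def)
    then show ?P
      using pair_finite_verts pair_sym_arcs in_arcsD1 in_arcsD2
      by (auto simp: symmetric_def)
  next
    assume P: ?P
    then have "finite (parcs G)" by (meson finite_SigmaI finite_subset)
    with P show "pair_graph G"
      by unfold_locales (auto simp: symmetric_def irrefl_def)
  qed
  have conn: "Digraph_Component.connected (with_proj G) \<longleftrightarrow> pverts G \<noteq> {} \<and>
     (\<forall>u \<in> pverts G. \<forall>v \<in> pverts G. (u, v) \<in> (parcs G)\<^sup>*)"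
    if g: "pair_graph G"
  proof -
    interpret pair_graph G by fact
    have "strongly_connected (with_proj (mk_symmetric (with_proj G))) \<longleftrightarrow>
        pverts G \<noteq> {} \<and> (\<forall>u \<in> pverts G. \<forall>v \<in> pverts G. reachable (with_proj G) u v)"
      using reachable_mk_symmetric_eq pair_sym_arcs by (simp add: strongly_connected_def)
    moreover have "reachable (with_proj G) u v \<longleftrightarrow> (u, v) \<in> (parcs G)\<^sup>*"
      if "u \<in> pverts G" for u v
    proof
      assume "reachable (with_proj G) u v"
      then show "(u, v) \<in> (parcs G)\<^sup>*"
        unfolding reachable_def by (auto dest: rtrancl_on_rtranclI)
    next
      assume "(u, v) \<in> (parcs G)\<^sup>*"
      then show "reachable (with_proj G) u v"
        using that
      proof (induction rule: rtrancl_induct)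
        case base
        then show ?case by simp
      next
        case (step y z)
        then show ?case using reachable_adj_trans by simp
      qed
    qed
    ultimately show ?thesis
      by (simp add: Digraph_Component.connected_def)
  qed
  show ?thesis
    using graph conn unfolding finite_connected_graph_def by blast
qed

lemma finite_connected_graph_cartesian_product:
  assumes "finite_connected_graph G\<^sub>1" "finite_connected_graph G\<^sub>2"
  shows "finite_connected_graph (cartesian_product G\<^sub>1 G\<^sub>2)"
proof -
  let ?E = "parcs (cartesian_product G\<^sub>1 G\<^sub>2)"
  note 1 = assms(1)[unfolded finite_connected_graph_iff]
  note 2 = assms(2)[unfolded finite_connected_graph_iff]
  have left: "((u, a), (v, a)) \<in> ?E\<^sup>*" if "(u, v) \<in> (parcs G\<^sub>1)\<^sup>*" "a \<in> pverts G\<^sub>2" for u v a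
    using that
  proof (induction rule: rtrancl_induct)
    case (step y z)
    then have "((y, a), (z, a)) \<in> ?E" using 1 by (auto simp: cartesian_product_def)
    with step show ?case by (meson rtrancl.rtrancl_into_rtrancl)
  qed simp
  have right: "((a, u), (a, v)) \<in> ?E\<^sup>*" if "(u, v) \<in> (parcs G\<^sub>2)\<^sup>*" "a \<in> pverts G\<^sub>1" for u v a
    using that
  proof (induction rule: rtrancl_induct)
    case (step y z)
    then have "((a, y), (a, z)) \<in> ?E" using 2 by (auto simp: cartesian_product_def)
    with step show ?case by (meson rtrancl.rtrancl_into_rtrancl)
  qed simp
  have "(p, q) \<in> ?E\<^sup>*"
    if "p \<in> pverts G\<^sub>1 \<times> pverts G\<^sub>2" "q \<in> pverts G\<^sub>1 \<times> pverts G\<^sub>2" for p q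
  proof -
    obtain u a v b where pq: "p = (u, a)" "q = (v, b)" by (metis surj_pair)
    have "(p, (v, a)) \<in> ?E\<^sup>*" using left 1 that pq by auto
    also have "((v, a), q) \<in> ?E\<^sup>*" using right 2 that pq by auto
    finally show ?thesis .
  qed
  moreover have "finite (pverts G\<^sub>1 \<times> pverts G\<^sub>2)" "pverts G\<^sub>1 \<times> pverts G\<^sub>2 \<noteq> {}"
    using 1 2 by auto
  moreover have "?E \<subseteq> (pverts G\<^sub>1 \<times> pverts G\<^sub>2) \<times> (pverts G\<^sub>1 \<times> pverts G\<^sub>2)" "irrefl ?E"
    using 1[THEN conjunct2, THEN conjunct2] 2[THEN conjunct2, THEN conjunct2]
    by (auto simp: cartesian_product_def irrefl_def)
  moreover have "sym ?E"
  proof (rule symI)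
    have "(y, x) \<in> parcs G\<^sub>1" if "(x, y) \<in> parcs G\<^sub>1" for x y using 1 that by (meson symD)
    moreover have "(y, x) \<in> parcs G\<^sub>2" if "(x, y) \<in> parcs G\<^sub>2" for x y using 2 that by (meson symD)
    ultimately show "(q, p) \<in> ?E" if "(p, q) \<in> ?E" for p q
      using that unfolding cartesian_product_def by fastforce
  qed
  moreover have "pverts (cartesian_product G\<^sub>1 G\<^sub>2) = pverts G\<^sub>1 \<times> pverts G\<^sub>2"
    by (simp add: cartesian_product_def)
  ultimately show ?thesis
    unfolding finite_connected_graph_iff by simp
qed

lemma pebbling_moves_along_edge:
  assumes "(u, w) \<in> parcs G" "u \<noteq> w" "2 * m \<le> count D u"
  shows "\<exists>D'. (pebbling_move G)\<^sup>*\<^sup>* D D' \<and> m \<le> count D' w"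
proof -
  have "\<exists>D'. (pebbling_move G)\<^sup>*\<^sup>* D D' \<and> j \<le> count D' w \<and> 2 * (m - j) \<le> count D' u" if "j \<le> m" for j
    using that
  proof (induction j)
    case 0
    then show ?case using assms by auto
  next
    case (Suc j)
    then obtain D' where D': "(pebbling_move G)\<^sup>*\<^sup>* D D'" "j \<le> count D' w" "2 * (m - j) \<le> count D' u"
      by auto
    have "pebbling_move G D' (D' - {#u, u#} + {#w#})"
      using assms(1) D'(3) Suc.prems by (intro pebbling_move.intros) auto
    with D'(1) have "(pebbling_move G)\<^sup>*\<^sup>* D (D' - {#u, u#} + {#w#})" by simp
    moreover have "Suc j \<le> count (D' - {#u, u#} + {#w#}) w" using D'(2) assms(2) by simp
    moreover have "2 * (m - Suc j) \<le> count (D' - {#u, u#} + {#w#}) u"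
      using D'(3) assms(2) by simp
    ultimately show ?case by blast
  qed
  from this[of m] show ?thesis by auto
qed

lemma vertex_solvable_if_large:
  assumes "irrefl (parcs G)" "(u, v) \<in> parcs G ^^ d" "2 ^ d \<le> count D u"
  shows "vertex_solvable G v D"
  using assms(2,3)
proof (induction d arbitrary: u D)
  case 0
  then have "v \<in># D" by (simp add: Suc_le_eq)
  then show ?case unfolding vertex_solvable_def by blast
next
  case (Suc d)
  then obtain w where w: "(u, w) \<in> parcs G" "(w, v) \<in> parcs G ^^ d"
    by (meson relpow_Suc_E2)
  moreover have "u \<noteq> w" using w(1) assms(1) by (auto simp: irrefl_def)
  ultimately obtain D' where "(pebbling_move G)\<^sup>*\<^sup>* D D'" "2 ^ d \<le> count D' w"
    using pebbling_moves_along_edge[of u w G "2 ^ d" D] Suc.prems(2) by auto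
  with Suc.IH[OF w(2)] show ?case
    unfolding vertex_solvable_def by (meson rtranclp_trans)
qed

lemma P_half_attained:
  assumes "finite_connected_graph G"
  shows "measure_pmf.prob (pmf_of_set (configurations G (P_half G))) {D. solvable G D} \<ge> 1/2"
proof -
  note G = assms[unfolded finite_connected_graph_iff]
  let ?V = "pverts G"
  have "\<forall>p \<in> ?V \<times> ?V. \<exists>d. p \<in> parcs G ^^ d"
    using G by (auto dest: rtrancl_imp_relpow)
  then obtain d where d: "\<And>p. p \<in> ?V \<times> ?V \<Longrightarrow> p \<in> parcs G ^^ d p" by metis
  define m where "m = Max (d ` (?V \<times> ?V))"
  define k where "k = card ?V * 2 ^ m"
  have "solvable G D" if D: "D \<in> configurations G k" for D
  proof -
    have "\<exists>u \<in> ?V. 2 ^ m \<le> count D u"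
    proof (rule ccontr)
      assume "\<not> ?thesis"
      then have "(\<Sum>u\<in>?V. count D u) < (\<Sum>u\<in>?V. 2 ^ m)"
        using G by (intro sum_strict_mono) auto
      moreover have "size D = (\<Sum>u\<in>?V. count D u)"
        unfolding size_multiset_overloaded_eq using D G
        by (intro sum.mono_neutral_left) (auto simp: configurations_def not_in_iff)
      ultimately show False using D by (simp add: configurations_def k_def)
    qed
    then obtain u where u: "u \<in> ?V" "2 ^ m \<le> count D u" by blast
    have "vertex_solvable G v D" if v: "v \<in> ?V" for v
    proof (rule vertex_solvable_if_large)
      show "irrefl (parcs G)" "(u, v) \<in> parcs G ^^ d (u, v)" using G d u v by auto
      have "d (u, v) \<le> m" unfolding m_def using G u v by (intro Max_ge) auto
      then have "(2::nat) ^ d (u, v) \<le> 2 ^ m" by simp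
      with u show "2 ^ d (u, v) \<le> count D u" by linarith
    qed
    then show ?thesis by (simp add: solvable_def)
  qed
  then have "configurations G k \<inter> {D. solvable G D} = configurations G k" by auto
  moreover have "finite (configurations G k)" "configurations G k \<noteq> {}"
    using finite_configurations configurations_nonempty G by blast+
  ultimately have "measure_pmf.prob (pmf_of_set (configurations G k)) {D. solvable G D} = 1"
    by (simp add: measure_pmf_of_set)
  then have "measure_pmf.prob (pmf_of_set (configurations G k)) {D. solvable G D} \<ge> 1/2"
    by linarith
  then show ?thesis
    unfolding P_half_def by (rule LeastI)
qed

end

(*
  Take both factors to be the star on N = m^2 vertices. A configuration on a star is solvable as soon
  as two leaves carry two pebbles each, so by the birthday paradox P_half is O(sqrt N) and the product
  of the two values is O(N). In the product of two stars, a pebble can only reach the vertex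
  (hub, hub) if some (hub, leaf) or (leaf, hub) first gets two pebbles. For random configurations of
  k pebbles on the N^2 vertices this needs k of order about N^(5/4): every cause is a fixed pattern of
  e = 2, 3 or 4 pebbles, which occurs with probability at most (k/N^2)^e, and there are only N^(e-1)
  such patterns in each direction.
*)
theory Submission
  imports Defs
begin

section \<open>Probability that a random configuration contains a given pattern of pebbles\<close>

lemma card_set_mset_le_size: "card (set_mset D) \<le> size D"
proof -
  have "card (set_mset D) = (\<Sum>v\<in>set_mset D. 1)" by simp
  also have "\<dots> \<le> (\<Sum>v\<in>set_mset D. count D v)" by (intro sum_mono) simp
  finally show ?thesis by (simp add: size_multiset_overloaded_eq)
qed

text \<open>Double counting: adding a pebble on \<open>v\<close> to \<open>D\<close> and recording
  \<open>v\<close> is injective, and a configuration of \<open>Suc k\<close> pebbles arises from at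
  most \<open>Suc k\<close> choices of the added vertex. Hence dropping one pebble changes the
  number of configurations by a controlled factor.\<close>

lemma card_configurations_Suc_ge:
  assumes "finite (pverts G)"
  shows "card (pverts G) * card (configurations G k) \<le> Suc k * card (configurations G (Suc k))"
proof -
  let ?f = "\<lambda>(v, D). (add_mset v D, v)"
  let ?B = "Sigma (configurations G (Suc k)) set_mset"
  note fin = finite_configurations[OF assms]
  have "card (pverts G \<times> configurations G k) \<le> card ?B"
  proof (rule card_inj_on_le)
    show "inj_on ?f (pverts G \<times> configurations G k)" by (auto simp: inj_on_def)
    show "?f ` (pverts G \<times> configurations G k) \<subseteq> ?B" by (auto simp: configurations_def)
    show "finite ?B" using fin by auto
  qed
  also have "card ?B = (\<Sum>D\<in>configurations G (Suc k). card (set_mset D))"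
    using fin by simp
  also have "\<dots> \<le> (\<Sum>D\<in>configurations G (Suc k). Suc k)"
    by (intro sum_mono) (metis (mono_tags, lifting) card_set_mset_le_size configurations_def mem_Collect_eq)
  finally show ?thesis by (simp add: card_cartesian_product mult.commute)
qed

text \<open>Removing the pattern one pebble at a time costs a factor of at most k divided by the
  number of vertices each time. This is the probability bound multiplied out, so that the induction
  stays in the natural numbers; \<open>k\<close> varies because each removal lowers it.\<close>

lemma card_configurations_containing:
  assumes fin: "finite (pverts G)"
  shows "card {D \<in> configurations G k. E \<subseteq># D} * card (pverts G) ^ size E
           \<le> k ^ size E * card (configurations G k)"
proof (induction E arbitrary: k)
  case empty
  then show ?case by simp
next
  case (add v E)
  show ?case
  proof (cases k)
    case 0
    then have "{D \<in> configurations G k. add_mset v E \<subseteq># D} = {}"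
      by (auto simp: configurations_def)
    then show ?thesis by (simp only: card.empty mult_0 le0)
  next
    case (Suc j)
    let ?N = "card (pverts G)"
    let ?A = "{D \<in> configurations G j. E \<subseteq># D}"
    have "{D \<in> configurations G k. add_mset v E \<subseteq># D} \<subseteq> add_mset v ` ?A"
    proof
      fix D assume D: "D \<in> {D \<in> configurations G k. add_mset v E \<subseteq># D}"
      then have "v \<in># D" by (auto dest: mset_subset_eqD)
      then obtain D' where "D = add_mset v D'" by (meson mset_add)
      with D show "D \<in> add_mset v ` ?A" by (auto simp: configurations_def Suc)
    qed
    moreover have "finite ?A" using finite_configurations[OF fin] by simp
    ultimately have "card {D \<in> configurations G k. add_mset v E \<subseteq># D} \<le> card ?A"
      by (meson card_image_le card_mono finite_imageI le_trans)
    then have "card {D \<in> configurations G k. add_mset v E \<subseteq># D} * ?N ^ size (add_mset v E)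
        \<le> ?N * (card ?A * ?N ^ size E)"
      by (simp add: mult.left_commute)
    also have "\<dots> \<le> ?N * (j ^ size E * card (configurations G j))"
      using add.IH by (rule mult_le_mono2)
    also have "\<dots> = j ^ size E * (?N * card (configurations G j))" by simp
    also have "\<dots> \<le> k ^ size E * (k * card (configurations G k))"
    proof (rule mult_le_mono)
      show "j ^ size E \<le> k ^ size E" using Suc by (intro power_mono) auto
      show "?N * card (configurations G j) \<le> k * card (configurations G k)"
        using card_configurations_Suc_ge[OF fin, of j] unfolding Suc .
    qed
    finally show ?thesis by (simp add: mult_ac)
  qed
qed

lemma prob_containing_le:
  assumes "finite (pverts G)" "pverts G \<noteq> {}"
  shows "measure_pmf.prob (pmf_of_set (configurations G k)) {D. E \<subseteq># D}
           \<le> (real k / real (card (pverts G))) ^ size E"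
proof -
  let ?N = "card (pverts G)" and ?K = "configurations G k"
  have K: "finite ?K" "?K \<noteq> {}"
    using finite_configurations configurations_nonempty assms by blast+
  have pos: "?N > 0" "card ?K > 0" using assms K by (auto simp: card_gt_0_iff)
  have "?K \<inter> {D. E \<subseteq># D} = {D \<in> ?K. E \<subseteq># D}" by auto
  moreover have "real (card {D \<in> ?K. E \<subseteq># D}) * real ?N ^ size E \<le> real k ^ size E * real (card ?K)"
    using card_configurations_containing[OF assms(1), of k E]
    by (metis of_nat_le_iff of_nat_mult of_nat_power)
  ultimately show ?thesis
    using pos K by (simp add: measure_pmf_of_set power_divide divide_simps mult.commute)
qed

lemma prob_Un_le:
  assumes "measure_pmf.prob P A \<le> a" "measure_pmf.prob P B \<le> b"
  shows "measure_pmf.prob P (A \<union> B) \<le> a + b"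
  using measure_Un_le[of A "measure_pmf P" B] assms by simp

lemma prob_containing_some_le:
  assumes "finite (pverts G)" "pverts G \<noteq> {}" "finite I" "\<And>i. i \<in> I \<Longrightarrow> size (E i) = e"
  shows "measure_pmf.prob (pmf_of_set (configurations G k)) {D. \<exists>i\<in>I. E i \<subseteq># D}
           \<le> real (card I) * (real k / real (card (pverts G))) ^ e"
proof -
  let ?p = "pmf_of_set (configurations G k)"
  have "measure_pmf.prob ?p (\<Union>i\<in>I. {D. E i \<subseteq># D}) \<le> (\<Sum>i\<in>I. measure_pmf.prob ?p {D. E i \<subseteq># D})"
    using assms(3) by (intro measure_pmf.finite_measure_subadditive_finite) auto
  also have "\<dots> \<le> (\<Sum>i\<in>I. (real k / real (card (pverts G))) ^ e)"
    using prob_containing_le[OF assms(1,2)] assms(4) by (intro sum_mono) metis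
  also have "(\<Union>i\<in>I. {D. E i \<subseteq># D}) = {D. \<exists>i\<in>I. E i \<subseteq># D}" by auto
  finally show ?thesis by simp
qed

section \<open>Solvability on stars\<close>

text \<open>The hub is 0 and is included in \<open>N\<close>, so there are \<open>N - 1\<close>
  leaves.\<close>

definition star :: "nat \<Rightarrow> nat pair_pre_digraph" where
  "star N = \<lparr> pverts = {0..<N}, parcs = {(u, w). u < N \<and> w < N \<and> u \<noteq> w \<and> (u = 0 \<or> w = 0)} \<rparr>"

lemma pverts_star [simp]: "pverts (star N) = {0..<N}"
  and parcs_star [simp]: "(u, w) \<in> parcs (star N) \<longleftrightarrow> u < N \<and> w < N \<and> u \<noteq> w \<and> (u = 0 \<or> w = 0)"
  by (auto simp: star_def)

lemma irrefl_star: "irrefl (parcs (star N))"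
  by (auto simp: irrefl_def)

lemma finite_connected_star:
  assumes "N > 0"
  shows "finite_connected_graph (star N)"
proof -
  have "(u, v) \<in> (parcs (star N))\<^sup>*" if "u < N" "v < N" for u v
  proof -
    have "(u, 0) \<in> (parcs (star N))\<^sup>*" using that assms by (cases "u = 0") auto
    also have "(0, v) \<in> (parcs (star N))\<^sup>*" using that assms by (cases "v = 0") auto
    finally show ?thesis .
  qed
  then show ?thesis
    using assms irrefl_star unfolding finite_connected_graph_iff
    by (auto intro!: symI simp: star_def)
qed

text \<open>Every leaf is one move away from a hub with two pebbles, so solvability reduces to
  gathering two pebbles there.\<close>

lemma solvable_if_reaches_two_on_hub:
  assumes "(pebbling_move (star N))\<^sup>*\<^sup>* D D'" "2 \<le> count D' 0"
  shows "solvable (star N) D"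
  unfolding solvable_def
proof
  fix v assume v: "v \<in> pverts (star N)"
  have "vertex_solvable (star N) v D'"
  proof (cases "v = 0")
    case True
    then have "v \<in># D'" using assms(2) by (auto simp flip: count_greater_zero_iff)
    then show ?thesis unfolding vertex_solvable_def by blast
  next
    case False
    then show ?thesis
      using v assms(2) irrefl_star by (intro vertex_solvable_if_large[of _ 0 _ 1]) auto
  qed
  then show "vertex_solvable (star N) v D"
    using assms(1) unfolding vertex_solvable_def by (meson rtranclp_trans)
qed

text \<open>Four pebbles on a leaf send two to the hub.\<close>

lemma solvable_star_if_four:
  assumes "u < N" "4 \<le> count D u"
  shows "solvable (star N) D"
proof (cases "u = 0")
  case True
  then show ?thesis using assms solvable_if_reaches_two_on_hub[of N D D] by auto
next
  case False
  then show ?thesis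
    using assms pebbling_moves_along_edge[of u 0 "star N" 2 D]
    by (auto intro: solvable_if_reaches_two_on_hub)
qed

text \<open>Two leaves send one pebble each to the hub; if one of the vertices is the hub, its own
  two pebbles suffice.\<close>

lemma solvable_star_if_two_pairs:
  assumes "u < N" "w < N" "u \<noteq> w" "2 \<le> count D u" "2 \<le> count D w"
  shows "solvable (star N) D"
proof (cases "u = 0 \<or> w = 0")
  case True
  then show ?thesis using assms solvable_if_reaches_two_on_hub[of N D D] by auto
next
  case False
  let ?D1 = "D - {#u, u#} + {#0#}"
  let ?D2 = "?D1 - {#w, w#} + {#0#}"
  have "pebbling_move (star N) D ?D1" "pebbling_move (star N) ?D1 ?D2"
    using assms False by (intro pebbling_move.intros; auto)+
  then have "(pebbling_move (star N))\<^sup>*\<^sup>* D ?D2" by (meson converse_rtranclp_into_rtranclp r_into_rtranclp)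
  moreover have "2 \<le> count ?D2 0" using False by simp
  ultimately show ?thesis by (rule solvable_if_reaches_two_on_hub)
qed

section \<open>Upper bound for \<open>P_half\<close> of a star by switching\<close>

definition singles :: "'a multiset \<Rightarrow> 'a set" where
  "singles D = {v. count D v = 1}"

definition repeated :: "'a multiset \<Rightarrow> 'a set" where
  "repeated D = {v. 2 \<le> count D v}"

lemma set_mset_eq_singles_Un_repeated: "set_mset D = singles D \<union> repeated D"
  by (auto simp: singles_def repeated_def simp flip: count_greater_zero_iff)

lemma finite_singles: "finite (singles D)" and finite_repeated: "finite (repeated D)"
  by (metis finite_Un finite_set_mset set_mset_eq_singles_Un_repeated)+

text \<open>All pebbles that are not alone share one vertex, which holds at most 3. Unsolvable
  configurations on a star satisfy both hypotheses.\<close>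

lemma size_le_card_singles:
  assumes "card (repeated D) \<le> 1" "\<And>v. count D v \<le> 3"
  shows "size D \<le> card (singles D) + 3"
proof -
  have "size D = (\<Sum>v\<in>singles D. count D v) + (\<Sum>v\<in>repeated D. count D v)"
    unfolding size_multiset_overloaded_eq set_mset_eq_singles_Un_repeated
    by (rule sum.union_disjoint[OF finite_singles finite_repeated])
       (auto simp: singles_def repeated_def)
  moreover have "(\<Sum>v\<in>singles D. count D v) = card (singles D)"
    by (simp add: singles_def)
  moreover have "(\<Sum>v\<in>repeated D. count D v) \<le> card (repeated D) * 3"
    using sum_bounded_above[of "repeated D" "count D" 3] assms(2) by simp
  ultimately show ?thesis using assms(1) by linarith
qed

text \<open>
  Switching: in an unsolvable configuration almost all pebbles are alone, so many ordered pairs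
  \<open>(u, v)\<close> of lone pebbles are available for moving the pebble on \<open>v\<close> to \<open>u\<close>. The result has at most
  two candidates for \<open>u\<close>, so it arises in few ways.
\<close>
lemma card_unsolvable_star:
  "card {D \<in> configurations (star N) k. \<not> solvable (star N) D} * ((k - 3) * (k - 4))
     \<le> 2 * N * card (configurations (star N) k)"
proof -
  let ?K = "configurations (star N) k"
  let ?U = "{D \<in> ?K. \<not> solvable (star N) D}"
  let ?X = "{D \<in> ?K. card (repeated D) \<le> 2}"
  let ?P = "\<lambda>D. Sigma (singles D) (\<lambda>u. singles D - {u})"
  \<comment> \<open>Keeping \<open>u\<close> and \<open>v\<close> in the image makes the switch
    reversible. In the target, \<open>u\<close> has at most two values and \<open>v\<close> at most
    \<open>N\<close>, which gives the factor \<open>2 * N\<close>.\<close>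
  let ?f = "\<lambda>(D, u, v). (add_mset u (D - {#v#}), u, v)"
  let ?B = "Sigma ?X (\<lambda>D. repeated D \<times> {0..<N})"
  have K: "finite ?K" by (simp add: finite_configurations)
  have U: "card (repeated D) \<le> 1" "count D v \<le> 3" if D: "D \<in> ?U" for D v
  proof -
    have V: "w < N" if "0 < count D w" for w using D that by (auto simp: configurations_def)
    show "count D v \<le> 3"
      using D V[of v] solvable_star_if_four[of v N D] by fastforce
    have "u = w" if "u \<in> repeated D" "w \<in> repeated D" for u w
      using D V[of u] V[of w] that solvable_star_if_two_pairs[of u N w D]
      by (fastforce simp: repeated_def)
    then show "card (repeated D) \<le> 1"
      by (metis One_nat_def card_le_Suc0_iff_eq finite_repeated)
  qed
  \<comment> \<open>At least k - 3 pebbles are alone, and the second one is chosen among the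
    remaining lone pebbles. Truncated subtraction is harmless for small \<open>k\<close>.\<close>
  have P: "(k - 3) * (k - 4) \<le> card (?P D)" if D: "D \<in> ?U" for D
  proof -
    have "k \<le> card (singles D) + 3"
      using size_le_card_singles[of D] U[OF D] D by (auto simp: configurations_def)
    moreover have "card (?P D) = card (singles D) * (card (singles D) - 1)"
      by (simp add: finite_singles)
    ultimately show ?thesis by (auto intro!: mult_le_mono)
  qed
  have "card ?U * ((k - 3) * (k - 4)) \<le> (\<Sum>D\<in>?U. card (?P D))"
    using sum_bounded_below[of ?U "(k - 3) * (k - 4)" "\<lambda>D. card (?P D)"] P by simp
  also have "\<dots> = card (Sigma ?U ?P)"
    using K by (subst card_SigmaI) (auto simp: finite_singles)
  also have "\<dots> \<le> card ?B"
  proof (rule card_inj_on_le)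
    show "finite ?B" using K by (auto simp: finite_repeated)
    show "inj_on ?f (Sigma ?U ?P)"
    proof (rule inj_onI)
      fix x y assume xy: "x \<in> Sigma ?U ?P" "y \<in> Sigma ?U ?P" "?f x = ?f y"
      obtain D u v where x: "x = (D, u, v)" by (cases x)
      obtain D' where y: "y = (D', u, v)" using xy(3) x by (cases y) auto
      have "v \<in># D" "v \<in># D'"
        using xy(1,2) x y by (auto simp: set_mset_eq_singles_Un_repeated)
      moreover have "D - {#v#} = D' - {#v#}" using xy(3) x y by simp
      ultimately show "x = y" unfolding x y by (metis insert_DiffM)
    qed
    show "?f ` Sigma ?U ?P \<subseteq> ?B"
    proof (rule image_subsetI)
      fix x assume "x \<in> Sigma ?U ?P"
      then obtain D u v where x: "x = (D, u, v)" and D: "D \<in> ?K" "\<not> solvable (star N) D"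
        and uv: "u \<in> singles D" "v \<in> singles D" "v \<noteq> u"
        by blast
      let ?D = "add_mset u (D - {#v#})"
      have mem: "u \<in># D" "v \<in># D" using uv by (auto simp: set_mset_eq_singles_Un_repeated)
      \<comment> \<open>Only the count of \<open>u\<close> rises, so at most one repeated vertex
        joins the at most one already present; hence the bound 2 in \<open>?X\<close>.\<close>
      have "repeated ?D \<subseteq> insert u (repeated D)" by (auto simp: repeated_def)
      then have "card (repeated ?D) \<le> card (insert u (repeated D))"
        by (intro card_mono) (auto simp: finite_repeated)
      also have "\<dots> \<le> Suc (card (repeated D))" by (rule card_insert_le_m1) auto
      also have "\<dots> \<le> 2" using U(1)[of D] D by simp
      finally have "card (repeated ?D) \<le> 2" .
      moreover have "size ?D = size D" using mem(2) by (simp add: size_Suc_Diff1)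
      then have "?D \<in> ?K" using D mem by (auto simp: configurations_def dest: in_diffD)
      moreover have "u \<in> repeated ?D" using uv by (auto simp: repeated_def singles_def)
      moreover have "v \<in> {0..<N}" using D mem by (auto simp: configurations_def)
      ultimately show "?f x \<in> ?B" using x by simp
    qed
  qed
  also have "\<dots> = (\<Sum>D\<in>?X. card (repeated D) * N)"
    using K by (subst card_SigmaI) (auto simp: finite_repeated card_cartesian_product)
  also have "\<dots> \<le> card ?X * (2 * N)"
    using sum_bounded_above[of ?X "\<lambda>D. card (repeated D) * N" "2 * N"] by simp
  also have "\<dots> \<le> card ?K * (2 * N)"
    using K by (intro mult_le_mono1 card_mono) auto
  finally show ?thesis by (simp add: mult.commute)
qed

text \<open>For k = 2m + 4 the switching factor is (2m + 1)(2m), at least 4N with N = m^2, against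
  2N on the other side, so at most half of the configurations are unsolvable. As
  \<open>P_half\<close> is a least value, one such k bounds it; monotonicity in k is not
  involved.\<close>

lemma P_half_star_le:
  assumes "m > 0"
  shows "P_half (star (m\<^sup>2)) \<le> 2 * m + 4"
proof -
  let ?G = "star (m\<^sup>2)"
  let ?K = "configurations ?G (2 * m + 4)"
  let ?U = "{D \<in> ?K. \<not> solvable ?G D}"
  have K: "finite ?K" "?K \<noteq> {}"
    using finite_configurations[of ?G] configurations_nonempty[of ?G] assms by auto
  have "card ?U * (4 * m\<^sup>2) \<le> card ?U * ((2 * m + 4 - 3) * (2 * m + 4 - 4))"
    by (intro mult_le_mono2) (simp add: power2_eq_square algebra_simps)
  also have "\<dots> \<le> 2 * m\<^sup>2 * card ?K" by (rule card_unsolvable_star)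
  finally have U: "2 * card ?U \<le> card ?K" using assms by (simp add: algebra_simps)
  have "?K \<inter> {D. solvable ?G D} = ?K - ?U" by auto
  moreover have "card (?K - ?U) = card ?K - card ?U"
    using K by (intro card_Diff_subset) auto
  ultimately have "2 * card (?K \<inter> {D. solvable ?G D}) \<ge> card ?K" using U by simp
  moreover have "card ?K > 0" using K by (simp add: card_gt_0_iff)
  ultimately have "measure_pmf.prob (pmf_of_set ?K) {D. solvable ?G D} \<ge> 1/2"
    using K by (simp add: measure_pmf_of_set divide_simps)
  then show ?thesis unfolding P_half_def by (rule Least_le)
qed

section \<open>An obstruction on products of stars that moves preserve\<close>

text \<open>
  Column \<open>j\<close> consists of the vertices \<open>(i, j)\<close>. The condition says that
  \<open>f (0, j) + (\<Sum>i\<noteq>0. f (i, j) div 2) \<le> 1\<close>, so the column cannot collect two pebbles on \<open>(0, j)\<close>.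
\<close>
definition no_column_gain :: "(nat \<times> nat \<Rightarrow> nat) \<Rightarrow> bool" where
  "no_column_gain f \<longleftrightarrow>
     (\<forall>j. f (0, j) \<le> 1) \<and>
     (\<forall>i j. 2 \<le> f (i, j) \<longrightarrow> f (0, j) = 0) \<and>
     (\<forall>i j. f (i, j) \<le> 3) \<and>
     (\<forall>i i' j. i \<noteq> i' \<longrightarrow> 2 \<le> f (i, j) \<longrightarrow> f (i', j) \<le> 1)"

lemma no_column_gainD:
  assumes "no_column_gain f"
  shows "f (0, j) \<le> 1" "2 \<le> f (i, j) \<Longrightarrow> f (0, j) = 0" "f (i, j) \<le> 3"
    "i \<noteq> i' \<Longrightarrow> 2 \<le> f (i, j) \<Longrightarrow> f (i', j) \<le> 1"
  using assms unfolding no_column_gain_def by simp_all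

text \<open>The condition forces (0, j) to be empty, (i, j) to hold at most 3 pebbles and every
  other vertex of column j at most 1. After the move no vertex of column j holds two pebbles, and
  the other columns are untouched.\<close>

lemma no_column_gain_move_to_hub:
  assumes "no_column_gain f" "2 \<le> f (i, j)" "i \<noteq> 0"
  shows "no_column_gain (f((i, j) := f (i, j) - 2, (0, j) := Suc (f (0, j))))" (is "no_column_gain ?g")
proof -
  note f = no_column_gainD[OF assms(1)]
  have 0: "f (0, j) = 0" "f (i, j) \<le> 3" "i' \<noteq> i \<Longrightarrow> f (i', j) \<le> 1" for i'
    using f(2)[of i j] f(3)[of i j] f(4)[of i i' j] assms(2) by auto
  have j: "?g (i', j) \<le> 1" for i'
    using 0(1) 0(2) 0(3)[of i'] assms(3) by (cases "i' = i"; cases "i' = 0") simp_all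
  have other: "?g (i', j') = f (i', j')" if "j' \<noteq> j" for i' j' using that by simp
  show ?thesis
    unfolding no_column_gain_def
  proof (intro conjI allI impI)
    fix x x' y
    show "?g (0, y) \<le> 1" by (metis f(1) j other)
    show "?g (x, y) \<le> 3"
    proof (cases "y = j")
      case True
      show ?thesis using j[of x] unfolding True by linarith
    next
      case False
      show ?thesis unfolding other[OF False] by (rule f(3))
    qed
    show "?g (0, y) = 0" if "2 \<le> ?g (x, y)"
    proof (cases "y = j")
      case True
      show ?thesis using that j[of x] unfolding True by linarith
    next
      case False
      show ?thesis using that unfolding other[OF False] by (rule f(2))
    qed
    show "?g (x', y) \<le> 1" if "x \<noteq> x'" "2 \<le> ?g (x, y)"
    proof (cases "y = j")
      case True
      show ?thesis unfolding True by (rule j)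
    next
      case False
      show ?thesis using that unfolding other[OF False] by (rule f(4))
    qed
  qed
qed

text \<open>Here a pebble leaves along a row for column 0 and lands on an empty vertex other than
  (0, 0). No vertex gains beyond one pebble and all (0, y) keep their counts, so every clause
  survives.\<close>

lemma no_column_gain_move_out:
  assumes "no_column_gain f" "i \<noteq> 0" "f (i, 0) = 0"
  shows "no_column_gain (f((i, j) := f (i, j) - 2, (i, 0) := Suc (f (i, 0))))" (is "no_column_gain ?g")
proof -
  note f = no_column_gainD[OF assms(1)]
  have le: "?g q \<le> f q \<or> ?g q \<le> 1" and hub: "?g (0, y) = f (0, y)" for q y
    using assms(2,3) by auto
  have two: "2 \<le> f q" if "2 \<le> ?g q" for q using le[of q] that by linarith
  show ?thesis
    unfolding no_column_gain_def
  proof (intro conjI allI impI)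
    fix x x' y
    show "?g (0, y) \<le> 1" unfolding hub by (rule f(1))
    show "?g (x, y) \<le> 3" using le[of "(x, y)"] f(3)[of x y] by linarith
    show "?g (0, y) = 0" if "2 \<le> ?g (x, y)" unfolding hub by (rule f(2)[OF two[OF that]])
    show "?g (x', y) \<le> 1" if "x \<noteq> x'" "2 \<le> ?g (x, y)"
      using le[of "(x', y)"] f(4)[OF that(1) two[OF that(2)]] by linarith
  qed
qed

text \<open>The invariant that keeps (0, 0) empty: its neighbours (0, j) and (i, 0) would need two
  pebbles. Composing with \<open>prod.swap\<close> exchanges rows and columns, so one predicate
  serves both directions.\<close>

definition stuck :: "(nat \<times> nat) multiset \<Rightarrow> bool" where
  "stuck D \<longleftrightarrow> (0, 0) \<notin># D \<and> no_column_gain (count D) \<and> no_column_gain (count D \<circ> prod.swap)"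

text \<open>A vertex with two pebbles has both coordinates nonzero, so its only neighbours are (0,
  j) and (i, 0). Either move is a move to the hub in one direction and a move out in the
  other.\<close>

lemma stuck_pebbling_move:
  assumes "pebbling_move (cartesian_product (star N) (star M)) D D'" "stuck D"
  shows "stuck D'"
  using assms(1)
proof cases
  case (1 u w)
  obtain i j where u: "u = (i, j)" by fastforce
  note st = assms(2)[unfolded stuck_def]
  have c: "no_column_gain (count D)" "no_column_gain (count D \<circ> prod.swap)" using st by auto
  have two: "2 \<le> count D (i, j)" using 1 u by simp
  have "i \<noteq> 0" "j \<noteq> 0"
  proof -
    have "count D (0, j') \<le> 1" "count D (j', 0) \<le> 1" for j'
      using c[unfolded no_column_gain_def, THEN conjunct1] by auto
    then show "i \<noteq> 0" "j \<noteq> 0" using two by (metis Suc_1 not_less_eq_eq)+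
  qed
  moreover have "count D (0, j) = 0" "count D (i, 0) = 0"
    using c[unfolded no_column_gain_def, THEN conjunct2, THEN conjunct1] two by auto
  ultimately have ij: "i \<noteq> 0" "j \<noteq> 0" "count D (0, j) = 0" "count D (i, 0) = 0" by auto
  have "w = (0, j) \<or> w = (i, 0)"
    using 1(2) u ij by (auto simp: cartesian_product_def)
  then show ?thesis
  proof
    assume w: "w = (0, j)"
    have e: "count D' = (count D)((i, j) := count D (i, j) - 2, (0, j) := Suc (count D (0, j)))"
      using 1 u w ij by (auto simp: fun_eq_iff)
    \<comment> \<open>After swapping, the same move leaves column i for column 0.\<close>
    have e2: "count D' \<circ> prod.swap = (count D \<circ> prod.swap)
      ((j, i) := (count D \<circ> prod.swap) (j, i) - 2, (j, 0) := Suc ((count D \<circ> prod.swap) (j, 0)))"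
      unfolding e by (auto simp: fun_eq_iff)
    show ?thesis
      unfolding stuck_def
    proof (intro conjI)
      show "(0, 0) \<notin># D'" using e ij st by (simp add: not_in_iff)
      show "no_column_gain (count D')"
        unfolding e using c two ij by (intro no_column_gain_move_to_hub)
      show "no_column_gain (count D' \<circ> prod.swap)"
        unfolding e2 using c two ij by (intro no_column_gain_move_out) auto
    qed
  next
    assume w: "w = (i, 0)"
    have e: "count D' = (count D)((i, j) := count D (i, j) - 2, (i, 0) := Suc (count D (i, 0)))"
      using 1 u w ij by (auto simp: fun_eq_iff)
    \<comment> \<open>After swapping, the same move goes to the hub of column i.\<close>
    have e2: "count D' \<circ> prod.swap = (count D \<circ> prod.swap)
      ((j, i) := (count D \<circ> prod.swap) (j, i) - 2, (0, i) := Suc ((count D \<circ> prod.swap) (0, i)))"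
      unfolding e by (auto simp: fun_eq_iff)
    show ?thesis
      unfolding stuck_def
    proof (intro conjI)
      show "(0, 0) \<notin># D'" using e ij st by (simp add: not_in_iff)
      show "no_column_gain (count D')"
        unfolding e using c two ij by (intro no_column_gain_move_out)
      show "no_column_gain (count D' \<circ> prod.swap)"
        unfolding e2 using c two ij by (intro no_column_gain_move_to_hub) auto
    qed
  qed
qed

lemma not_solvable_if_stuck:
  assumes "stuck D" "N > 0" "M > 0"
  shows "\<not> solvable (cartesian_product (star N) (star M)) D"
proof
  let ?G = "cartesian_product (star N) (star M)"
  assume "solvable ?G D"
  moreover have "(0, 0) \<in> pverts ?G" using assms by (simp add: cartesian_product_def)
  ultimately obtain D' where "(pebbling_move ?G)\<^sup>*\<^sup>* D D'" and mem: "(0, 0) \<in># D'"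
    unfolding solvable_def vertex_solvable_def by blast
  from this(1) have "stuck D'"
    by (induction rule: rtranclp_induct) (auto intro: assms(1) stuck_pebbling_move)
  with mem show False by (simp add: stuck_def)
qed

section \<open>Random configurations on the product of two stars\<close>

text \<open>Each violated clause exhibits a pattern of 2, 3 or 4 pebbles. The last two clauses share
  the third pattern, in which i = i' is allowed. The map \<open>g\<close> will be \<open>id\<close>
  for columns and \<open>prod.swap\<close> for rows.\<close>

lemma column_gain_cases:
  assumes "\<not> no_column_gain (\<lambda>p. count D (g p))" and g: "inj g"
  obtains j where "{#g (0, j), g (0, j)#} \<subseteq># D"
  | i j where "{#g (0, j), g (i, j), g (i, j)#} \<subseteq># D"
  | i i' j where "{#g (i, j), g (i, j), g (i', j), g (i', j)#} \<subseteq># D"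
proof -
  have inj: "g p = g q \<longleftrightarrow> p = q" for p q using g by (rule inj_eq)
  let ?f = "\<lambda>p. count D (g p)"
  consider j where "?f (0, j) \<ge> 2" | i j where "2 \<le> ?f (i, j)" "?f (0, j) \<ge> 1" "?f (0, j) < 2"
    | i j where "?f (i, j) \<ge> 4"
    | i i' j where "i \<noteq> i'" "?f (i, j) \<ge> 2" "?f (i', j) \<ge> 2"
  proof -
    have "no_column_gain ?f"
      if 1: "\<not> (\<exists>j. ?f (0, j) \<ge> 2)" and 2: "\<not> (\<exists>i j. 2 \<le> ?f (i, j) \<and> ?f (0, j) \<ge> 1 \<and> ?f (0, j) < 2)"
        and 3: "\<not> (\<exists>i j. ?f (i, j) \<ge> 4)" and 4: "\<not> (\<exists>i i' j. i \<noteq> i' \<and> ?f (i, j) \<ge> 2 \<and> ?f (i', j) \<ge> 2)"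
      unfolding no_column_gain_def
    proof (intro conjI allI impI)
      fix i i' j
      have lt: "?f (0, j) < 2" using 1 by (meson not_le)
      then show "?f (0, j) \<le> 1" by simp
      show "?f (i, j) \<le> 3" using 3[simplified, rule_format, of i j] by simp
      show "?f (0, j) = 0" if "2 \<le> ?f (i, j)" using 2 that lt by (metis less_one not_le)
      show "?f (i', j) \<le> 1" if "i \<noteq> i'" "2 \<le> ?f (i, j)"
        using 4 that by (metis Suc_1 not_less_eq_eq)
    qed
    then show ?thesis using assms(1) that by blast
  qed
  then show ?thesis
  proof cases
    case (1 j)
    then have "{#g (0, j), g (0, j)#} \<subseteq># D" by (auto simp: subseteq_mset_def)
    then show ?thesis by (rule that(1))
  next
    case (2 i j)
    \<comment> \<open>The hub count is below 2 in this case. With i = 0 the pattern would demand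
      three pebbles on one vertex.\<close>
    then have "i \<noteq> 0" by (metis not_le)
    then have "{#g (0, j), g (i, j), g (i, j)#} \<subseteq># D"
      using 2 by (auto simp: subseteq_mset_def inj)
    then show ?thesis by (rule that(2))
  next
    case (3 i j)
    then have "{#g (i, j), g (i, j), g (i, j), g (i, j)#} \<subseteq># D"
      by (auto simp: subseteq_mset_def)
    then show ?thesis by (rule that(3))
  next
    case (4 i i' j)
    then have "{#g (i, j), g (i, j), g (i', j), g (i', j)#} \<subseteq># D"
      by (auto simp: subseteq_mset_def inj)
    then show ?thesis by (rule that(3))
  qed
qed

text \<open>Union bound over the patterns: N choices of j, N^2 of (i, j) and N^3 of (i, i', j). The
  condition on \<open>g\<close> confines the indices of occupied vertices to these finite
  ranges.\<close>

lemma prob_column_gain_le: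
  fixes g :: "nat \<times> nat \<Rightarrow> nat \<times> nat" and N k :: nat
  assumes "N > 0" "inj g" and g: "\<And>i j. g (i, j) \<in> {0..<N} \<times> {0..<N} \<Longrightarrow> i < N \<and> j < N"
  defines "G \<equiv> cartesian_product (star N) (star N)"
  defines "p \<equiv> real k / real (N * N)"
  shows "measure_pmf.prob (pmf_of_set (configurations G k)) {D. \<not> no_column_gain (\<lambda>q. count D (g q))}
     \<le> real N * p ^ 2 + real N ^ 2 * p ^ 3 + real N ^ 3 * p ^ 4"
proof -
  let ?V = "{0..<N}" and ?P = "pmf_of_set (configurations G k)"
  let ?E2 = "\<lambda>j. {#g (0, j), g (0, j)#}"
  let ?E3 = "\<lambda>(i, j). {#g (0, j), g (i, j), g (i, j)#}"
  let ?E4 = "\<lambda>(i, i', j). {#g (i, j), g (i, j), g (i', j), g (i', j)#}"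
  let ?A2 = "{D. \<exists>x\<in>?V. ?E2 x \<subseteq># D}"
  let ?A3 = "{D. \<exists>x\<in>?V \<times> ?V. ?E3 x \<subseteq># D}"
  let ?A4 = "{D. \<exists>x\<in>?V \<times> ?V \<times> ?V. ?E4 x \<subseteq># D}"
  have G: "pverts G = ?V \<times> ?V" by (simp add: G_def cartesian_product_def)
  then have G': "finite (pverts G)" "pverts G \<noteq> {}" "card (pverts G) = N * N"
    using assms(1) by (auto simp: card_cartesian_product)
  have fin: "finite (configurations G k)" "configurations G k \<noteq> {}"
    using G' finite_configurations configurations_nonempty by blast+
  have "measure_pmf.prob ?P {D. \<not> no_column_gain (\<lambda>q. count D (g q))}
      \<le> measure_pmf.prob ?P (?A2 \<union> ?A3 \<union> ?A4)"
  \<comment> \<open>The inclusion is claimed only on the support, since other multisets may have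
    pebbles off the graph.\<close>
  proof (rule measure_pmf.finite_measure_mono_AE)
    show "AE D in measure_pmf ?P. D \<in> {D. \<not> no_column_gain (\<lambda>q. count D (g q))} \<longrightarrow> D \<in> ?A2 \<union> ?A3 \<union> ?A4"
    proof (rule AE_pmfI, rule impI)
      fix D assume "D \<in> set_pmf ?P" and nc: "D \<in> {D. \<not> no_column_gain (\<lambda>q. count D (g q))}"
      then have "set_mset D \<subseteq> ?V \<times> ?V" using fin G by (simp add: configurations_def)
      then have V: "i \<in> ?V \<and> j \<in> ?V" if "g (i, j) \<in># D" for i j using g[of i j] that by auto
      from nc have gain: "\<not> no_column_gain (\<lambda>q. count D (g q))" by simp
      show "D \<in> ?A2 \<union> ?A3 \<union> ?A4"
      proof (cases rule: column_gain_cases[OF gain assms(2)])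
        case (1 j)
        then have "g (0, j) \<in># D" by (auto dest: mset_subset_eqD)
        with 1 V show ?thesis by blast
      next
        case (2 i j)
        then have "g (i, j) \<in># D" by (auto dest: mset_subset_eqD)
        with V have "(i, j) \<in> ?V \<times> ?V" by blast
        with 2 have "D \<in> ?A3" by (intro CollectI bexI[of _ "(i, j)"]) simp_all
        then show ?thesis by blast
      next
        case (3 i i' j)
        then have "g (i, j) \<in># D" "g (i', j) \<in># D" by (auto dest: mset_subset_eqD)
        with V have "(i, i', j) \<in> ?V \<times> ?V \<times> ?V" by blast
        with 3 have "D \<in> ?A4" by (intro CollectI bexI[of _ "(i, i', j)"]) simp_all
        then show ?thesis by blast
      qed
    qed
  qed auto
  also have "\<dots> \<le> real (card ?V) * p ^ 2 + real (card (?V \<times> ?V)) * p ^ 3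
      + real (card (?V \<times> ?V \<times> ?V)) * p ^ 4"
    unfolding p_def G'(3)[symmetric]
    by (intro prob_Un_le prob_containing_some_le) (use G' in auto)
  finally show ?thesis
    by (simp add: card_cartesian_product power2_eq_square power3_eq_cube mult.assoc)
qed

text \<open>A solvable configuration is not stuck, so (0, 0) is occupied or some column or row can
  gain. For k at most aN the resulting bound is of order 1/N for fixed a.\<close>

lemma prob_solvable_star_product_less:
  assumes a: "a \<ge> 1" and N: "real N > 14 * a ^ 4" and k: "real k \<le> a * real N"
  defines "G \<equiv> cartesian_product (star N) (star N)"
  shows "measure_pmf.prob (pmf_of_set (configurations G k)) {D. solvable G D} < 1/2"
proof -
  let ?P = "pmf_of_set (configurations G k)"
  let ?A = "\<lambda>g. {D. \<not> no_column_gain (\<lambda>q. count D (g q))}"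
  let ?H = "{D. {#(0, 0)#} \<subseteq># D}"
  define p where "p = real k / real (N * N)"
  have "1 \<le> a ^ 4" using a by simp
  with N have N0: "N > 0" by (cases N) auto
  have G: "pverts G = {0..<N} \<times> {0..<N}" by (simp add: G_def cartesian_product_def)
  have "{D. solvable G D} \<subseteq> ?H \<union> (?A id \<union> ?A prod.swap)"
    using not_solvable_if_stuck[OF _ N0 N0] unfolding G_def stuck_def
    by (auto simp: comp_def)
  then have "measure_pmf.prob ?P {D. solvable G D} \<le> measure_pmf.prob ?P (?H \<union> (?A id \<union> ?A prod.swap))"
    by (intro measure_pmf.finite_measure_mono) auto
  also have "\<dots> \<le> p + ((real N * p ^ 2 + real N ^ 2 * p ^ 3 + real N ^ 3 * p ^ 4)
      + (real N * p ^ 2 + real N ^ 2 * p ^ 3 + real N ^ 3 * p ^ 4))"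
  proof (intro prob_Un_le)
    show "measure_pmf.prob ?P ?H \<le> p"
      using prob_containing_le[of G k "{#(0, 0)#}"] G N0
      by (simp add: p_def card_cartesian_product)
    show "measure_pmf.prob ?P (?A id) \<le> real N * p ^ 2 + real N ^ 2 * p ^ 3 + real N ^ 3 * p ^ 4"
      unfolding G_def p_def by (rule prob_column_gain_le) (use N0 in auto)
    show "measure_pmf.prob ?P (?A prod.swap) \<le> real N * p ^ 2 + real N ^ 2 * p ^ 3 + real N ^ 3 * p ^ 4"
      unfolding G_def p_def by (rule prob_column_gain_le) (use N0 in auto)
  qed
  also have "\<dots> = p + 2 * (real N * p ^ 2 + real N ^ 2 * p ^ 3 + real N ^ 3 * p ^ 4)" by simp
  finally have le: "measure_pmf.prob ?P {D. solvable G D} \<le> \<dots>" .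
  \<comment> \<open>Since p = k/N^2, x is k/N, and N times the bound becomes a polynomial in x
    alone. Its coefficients sum to 1 + 2 * 3 = 7, and comparison with 1/2 doubles this to the 14 of
    the hypothesis.\<close>
  define x where "x = real N * p"
  have x: "0 \<le> x" "x \<le> a" using k N0 by (auto simp: x_def p_def divide_simps)
  have pw: "x ^ e \<le> a ^ 4" if "e \<le> 4" for e
    using power_mono[OF x(2,1), of e] power_increasing[OF that a] by linarith
  have "real N * (p + 2 * (real N * p ^ 2 + real N ^ 2 * p ^ 3 + real N ^ 3 * p ^ 4))
      = x ^ 1 + 2 * (x ^ 2 + x ^ 3 + x ^ 4)"
    by (simp add: x_def power_mult_distrib algebra_simps eval_nat_numeral)
  also have "\<dots> \<le> 7 * a ^ 4" using pw[of 1] pw[of 2] pw[of 3] pw[of 4] by simp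
  also have "\<dots> < real N * (1/2)" using N by simp
  finally have "p + 2 * (real N * p ^ 2 + real N ^ 2 * p ^ 3 + real N ^ 3 * p ^ 4) < 1/2"
    using N0 by (simp only: mult_less_cancel_left_pos of_nat_0_less_iff)
  with le show ?thesis by (rule le_less_trans)
qed

section \<open>Contradiction for an arbitrary constant\<close>

theorem mainTheorem3:
  shows "\<not> (\<exists>C :: real. \<forall>(G\<^sub>1 :: nat pair_pre_digraph) (G\<^sub>2 :: nat pair_pre_digraph).
           finite_connected_graph G\<^sub>1 \<longrightarrow> finite_connected_graph G\<^sub>2 \<longrightarrow>
           real (P_half (cartesian_product G\<^sub>1 G\<^sub>2)) \<le> C * real (P_half G\<^sub>1) * real (P_half G\<^sub>2))"
proof
  assume "\<exists>C :: real. \<forall>(G\<^sub>1 :: nat pair_pre_digraph) (G\<^sub>2 :: nat pair_pre_digraph).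
           finite_connected_graph G\<^sub>1 \<longrightarrow> finite_connected_graph G\<^sub>2 \<longrightarrow>
           real (P_half (cartesian_product G\<^sub>1 G\<^sub>2)) \<le> C * real (P_half G\<^sub>1) * real (P_half G\<^sub>2)"
  then obtain C :: real where C: "\<And>(G\<^sub>1 :: nat pair_pre_digraph) (G\<^sub>2 :: nat pair_pre_digraph).
           finite_connected_graph G\<^sub>1 \<Longrightarrow> finite_connected_graph G\<^sub>2 \<Longrightarrow>
           real (P_half (cartesian_product G\<^sub>1 G\<^sub>2)) \<le> C * real (P_half G\<^sub>1) * real (P_half G\<^sub>2)"
    by blast
  \<comment> \<open>The 36 is 6^2, from 2m + 4 \<le> 6m in each factor. The maximum with 1 gives a
    \<ge> 1 whatever the sign of \<open>C\<close>.\<close>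
  define a where "a = 36 * max 1 C"
  have a: "a \<ge> 1" by (simp add: a_def)
  obtain m :: nat where m: "real m > 14 * a ^ 4" using reals_Archimedean2 by blast
  have "1 \<le> a ^ 4" using a by simp
  with m have m0: "m > 0" by (cases m) auto
  define G where "G = star (m\<^sup>2)"
  have con: "finite_connected_graph G" unfolding G_def using m0 by (intro finite_connected_star) simp
  define k where "k = P_half (cartesian_product G G)"
  have "P_half G \<le> 6 * m" using P_half_star_le[OF m0] m0 unfolding G_def by linarith
  then have "real (P_half G) \<le> 6 * real m" by linarith
  then have sq: "real (P_half G) * real (P_half G) \<le> (6 * real m) * (6 * real m)"
    by (intro mult_mono) auto
  have "real k \<le> C * (real (P_half G) * real (P_half G))"
    using C[OF con con] by (simp add: k_def mult.assoc)
  also have "\<dots> \<le> max 1 C * (real (P_half G) * real (P_half G))"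
    by (intro mult_right_mono) auto
  also have "\<dots> \<le> max 1 C * ((6 * real m) * (6 * real m))"
    using sq by (intro mult_left_mono) auto
  also have "\<dots> = a * real (m\<^sup>2)" by (simp add: a_def power2_eq_square)
  finally have k: "real k \<le> a * real (m\<^sup>2)" .
  have "m \<le> m\<^sup>2" using m0 by (simp add: power2_eq_square)
  then have "real (m\<^sup>2) > 14 * a ^ 4" using m by linarith
  \<comment> \<open>At k = \<open>P_half\<close> of the product the probability is at least 1/2
    because the minimum is attained, yet k \<le> aN forces it below 1/2.\<close>
  from prob_solvable_star_product_less[OF a this k] show False
    using P_half_attained[OF finite_connected_graph_cartesian_product[OF con con]]
    by (simp add: k_def G_def)
qed

end
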